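(* Let $a_1,a_2,b_1,b_2,c_1,c_2$ be real numbers with $0\le a_1<1$, $0<b_1<1$, $a_2,b_2,c_1,c_2>0$. Let $n\in\mathbb N$, $0<\rho_1<\dots<\rho_n$, let $\nu_1,\dots,\nu_n>0$ satisfy $\sum_{i=1}^n\nu_i\le1$, and let $\beta_1,\dots,\beta_n\in\mathbb R$ satisfy $|\beta_1|<\rho_1$ and $|\beta_i-\beta_{i-1}|\le\rho_i-\rho_{i-1}$ for $2\le i\le n$. Consider the $(n+2)$-dimensional piecewise linear system $$x_t=b_1p_t+(1-b_1)x_{t-1}+b_2y_t,$$ $$y_t=(1-a_1)y_{t-1}-a_2(c_1x_t+c_2y_t-p_t),\qquad t\in\mathbb N,$$ $$p_t=\sum_{i=1}^n\nu_i\,\mathfrak p_{\rho_i}[\beta_i,x]_t,\qquad t\in\mathbb N\cup\{0\},$$ where $\mathfrak p_{\rho_i}$ is the play operator with threshold $\rho_i$ and $x=(x_0,x_1,\dots)$. If $c_1>1$, then any trajectory of this system converges, as $t\to\infty$, to an equilibrium point of this system.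
   Context: For $\rho>0$, the saturation function is $\Phi_\rho(v)=\rho$ if $v\ge\rho$, $\Phi_\rho(v)=v$ if $-\rho<v<\rho$, $\Phi_\rho(v)=-\rho$ if $v\le-\rho$. For $\beta\in[-\rho,\rho]$ and a real sequence $x=(x_0,x_1,\dots)$, the play operator is the sequence $\mathfrak p_\rho[\beta,x]=(w_0,w_1,\dots)$ with $w_0=x_0-\beta$ and $w_t=x_t+\Phi_\rho(w_{t-1}-x_t)$ for $t\in\mathbb N$. The state of the system at time $t$ is $(x_t,y_t,p^{(1)}_t,\dots,p^{(n)}_t)\in\mathbb R^{n+2}$ with $p^{(i)}_t=\mathfrak p_{\rho_i}[\beta_i,x]_t$; initial data are $x_0,y_0\in\mathbb R$ and $p^{(i)}_0=x_0-\beta_i$, with $\beta_i$ as restricted in the claim. A trajectory is a sequence of states satisfying all the equations (the equations are implicit in the time-$t$ variables). An equilibrium point is a state such that the constant sequence equal to this state is a trajectory, i.e. satisfies all the equations $x_t=b_1p_t+(1-b_1)x_{t-1}+b_2y_t$, $y_t=(1-a_1)y_{t-1}-a_2(c_1x_t+c_2y_t-p_t)$, $p_t=\sum_i\nu_ip^{(i)}_t$, $p^{(i)}_t=x_t+\Phi_{\rho_i}(p^{(i)}_{t-1}-x_t)$. *)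

theory Defs
  imports "HOL-Analysis.Analysis"
begin

definition saturation :: "real \<Rightarrow> real \<Rightarrow> real" where
  "saturation \<rho> v = (if v \<ge> \<rho> then \<rho> else if v \<le> - \<rho> then - \<rho> else v)"

primrec play :: "real \<Rightarrow> real \<Rightarrow> (nat \<Rightarrow> real) \<Rightarrow> nat \<Rightarrow> real" where
  "play \<rho> \<beta> x 0 = x 0 - \<beta>"
| "play \<rho> \<beta> x (Suc t) = x (Suc t) + saturation \<rho> (play \<rho> \<beta> x t - x (Suc t))"

text \<open>
  A state is a triple \<open>(x, y, q)\<close>, where \<open>q i\<close> is the value of the i-th play operator,
  i = 1, ..., n. Restricting \<open>q\<close> to extensional functions on \<open>{1..n}\<close> makes
  \<open>states n\<close> a copy of the (n+2)-dimensional space, and the limit notion of the product type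
  (product topology) restricts on it to the usual one.
\<close>

type_synonym state = "real \<times> real \<times> (nat \<Rightarrow> real)"

definition states :: "nat \<Rightarrow> state set" where
  "states n = UNIV \<times> UNIV \<times> ({1..n} \<rightarrow>\<^sub>E UNIV)"

abbreviation state_x :: "state \<Rightarrow> real" where
  "state_x z \<equiv> fst z"

abbreviation state_y :: "state \<Rightarrow> real" where
  "state_y z \<equiv> fst (snd z)"

abbreviation state_play :: "state \<Rightarrow> nat \<Rightarrow> real" where
  "state_play z \<equiv> snd (snd z)"

definition state_p :: "nat \<Rightarrow> (nat \<Rightarrow> real) \<Rightarrow> state \<Rightarrow> real" where
  "state_p n \<nu> z = (\<Sum>i=1..n. \<nu> i * state_play z i)"

definition xy_equations ::
  "real \<Rightarrow> real \<Rightarrow> real \<Rightarrow> real \<Rightarrow> real \<Rightarrow> real \<Rightarrow> nat \<Rightarrow> (nat \<Rightarrow> real) \<Rightarrow> (nat \<Rightarrow> state) \<Rightarrow> bool" where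
  "xy_equations a1 a2 b1 b2 c1 c2 n \<nu> z \<longleftrightarrow>
    (\<forall>t. state_x (z (Suc t)) =
           b1 * state_p n \<nu> (z (Suc t)) + (1 - b1) * state_x (z t) + b2 * state_y (z (Suc t)) \<and>
         state_y (z (Suc t)) =
           (1 - a1) * state_y (z t)
             - a2 * (c1 * state_x (z (Suc t)) + c2 * state_y (z (Suc t)) - state_p n \<nu> (z (Suc t))))"

definition trajectory ::
  "real \<Rightarrow> real \<Rightarrow> real \<Rightarrow> real \<Rightarrow> real \<Rightarrow> real \<Rightarrow> nat \<Rightarrow> (nat \<Rightarrow> real) \<Rightarrow> (nat \<Rightarrow> real) \<Rightarrow>
    (nat \<Rightarrow> real) \<Rightarrow> (nat \<Rightarrow> state) \<Rightarrow> bool" where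
  "trajectory a1 a2 b1 b2 c1 c2 n \<rho> \<nu> \<beta> z \<longleftrightarrow>
    (\<forall>t. z t \<in> states n) \<and>
    xy_equations a1 a2 b1 b2 c1 c2 n \<nu> z \<and>
    (\<forall>t. \<forall>i\<in>{1..n}. state_play (z t) i = play (\<rho> i) (\<beta> i) (\<lambda>s. state_x (z s)) t)"

definition play_equations :: "nat \<Rightarrow> (nat \<Rightarrow> real) \<Rightarrow> (nat \<Rightarrow> state) \<Rightarrow> bool" where
  "play_equations n \<rho> z \<longleftrightarrow>
    (\<forall>t. \<forall>i\<in>{1..n}. state_play (z (Suc t)) i =
       state_x (z (Suc t)) + saturation (\<rho> i) (state_play (z t) i - state_x (z (Suc t))))"

text \<open>
  An equilibrium satisfies the equations of motion as a constant sequence; the initial condition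
  with the particular offsets \<open>\<beta>\<close> of a given trajectory is not imposed on it.
\<close>

definition equilibrium ::
  "real \<Rightarrow> real \<Rightarrow> real \<Rightarrow> real \<Rightarrow> real \<Rightarrow> real \<Rightarrow> nat \<Rightarrow> (nat \<Rightarrow> real) \<Rightarrow> (nat \<Rightarrow> real) \<Rightarrow>
    state \<Rightarrow> bool" where
  "equilibrium a1 a2 b1 b2 c1 c2 n \<rho> \<nu> e \<longleftrightarrow>
    e \<in> states n \<and>
    xy_equations a1 a2 b1 b2 c1 c2 n \<nu> (\<lambda>_. e) \<and>
    play_equations n \<rho> (\<lambda>_. e)"

lemma trajectory_iff:
  "trajectory a1 a2 b1 b2 c1 c2 n \<rho> \<nu> \<beta> z \<longleftrightarrow>
    (\<forall>t. z t \<in> states n) \<and> xy_equations a1 a2 b1 b2 c1 c2 n \<nu> z \<and> play_equations n \<rho> z \<and>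
    (\<forall>i\<in>{1..n}. state_play (z 0) i = state_x (z 0) - \<beta> i)"
proof -
  have "(\<forall>t. \<forall>i\<in>{1..n}. state_play (z t) i = play (\<rho> i) (\<beta> i) (\<lambda>s. state_x (z s)) t) \<longleftrightarrow>
    play_equations n \<rho> z \<and> (\<forall>i\<in>{1..n}. state_play (z 0) i = state_x (z 0) - \<beta> i)"
    (is "?L \<longleftrightarrow> ?R")
  proof
    assume ?L
    then show ?R by (simp add: play_equations_def)
  next
    assume R: ?R
    have "\<forall>i\<in>{1..n}. state_play (z t) i = play (\<rho> i) (\<beta> i) (\<lambda>s. state_x (z s)) t" for t
      by (induction t) (use R in \<open>simp_all add: play_equations_def\<close>)
    then show ?L by blast
  qed
  then show ?thesis by (auto simp: trajectory_def)
qed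

end

theory Submission
  imports Defs
begin

text \<open>
  Put \<open>u = x - p = (1 - \<Sum>\<nu>\<^sub>i) x + \<Sum>\<nu>\<^sub>i s\<^sub>i\<close> with the stop outputs \<open>s\<^sub>i = x - p\<^sub>i\<close>, and
  let \<open>v\<^sub>t = x\<^sub>t - x\<^sub>t\<^sub>-\<^sub>1\<close>. Eliminating \<open>y\<close> gives an implicit Euler scheme for a damped oscillator,
  \<open>A B \<Delta>v\<^sub>t + A b\<^sub>1 \<Delta>u\<^sub>t + d B v\<^sub>t + m u\<^sub>t + K x\<^sub>t = 0\<close>, where
  \<open>A = 1 - a\<^sub>1\<close>, \<open>B = 1 - b\<^sub>1\<close>, \<open>d = a\<^sub>1 + a\<^sub>2 c\<^sub>2\<close>, \<open>m = d b\<^sub>1 + a\<^sub>2 b\<^sub>2\<close> and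
  \<open>K = a\<^sub>2 b\<^sub>2 (c\<^sub>1 - 1)\<close> are positive. Multiplying by \<open>v\<^sub>t\<close> and using that the stop operator is monotone and dissipative,
  the energy \<open>A B v\<^sup>2 + m ((1 - \<Sum>\<nu>\<^sub>i) x\<^sup>2 + \<Sum>\<nu>\<^sub>i s\<^sub>i\<^sup>2) + K x\<^sup>2\<close> decreases by at least
  \<open>2 d B v\<^sub>t\<^sup>2\<close>. Hence \<open>v\<close> and \<open>\<Delta>u\<close> tend to zero, and so does \<open>m u + K x\<close>. The latter is
  a positive multiple of \<open>x\<close> plus a nonnegative combination of stops of \<open>x\<close>; such a combination
  controls every running maximum and minimum of \<open>x\<close>, which makes \<open>x\<close> a Cauchy sequence.
\<close>

lemma saturation_eq_max_min: "0 \<le> \<rho> \<Longrightarrow> saturation \<rho> v = max (- \<rho>) (min \<rho> v)"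
  by (auto simp: saturation_def)

lemma tendsto_saturation:
  assumes "0 \<le> \<rho>" and "(f \<longlongrightarrow> l) F"
  shows "((\<lambda>t. saturation \<rho> (f t)) \<longlongrightarrow> saturation \<rho> l) F"
  unfolding saturation_eq_max_min[OF assms(1)]
  by (intro tendsto_intros assms(2))

lemma tendsto_coordinatewise:
  "(f \<longlongrightarrow> l) F \<longleftrightarrow> (\<forall>i. ((\<lambda>t. f t i) \<longlongrightarrow> l i) F)"
  using limitin_componentwise[of "\<lambda>_. euclidean" UNIV f l F]
  by (simp add: euclidean_product_topology)

text \<open>Stated for a bare recursion instead of \<open>play\<close>, so that the play coordinates
  of a trajectory and their negatives are both instances.\<close>

locale play_sequence =
  fixes \<rho> :: real and x q :: "nat \<Rightarrow> real"
  assumes threshold_nonneg: "0 \<le> \<rho>"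
    and initial: "\<bar>x 0 - q 0\<bar> \<le> \<rho>"
    and step: "q (Suc t) = x (Suc t) + saturation \<rho> (q t - x (Suc t))"
begin

text \<open>The update projects \<open>q t\<close> onto the interval of radius \<open>\<rho>\<close>
  around \<open>x (Suc t)\<close>; in this form linear arithmetic can split the cases.\<close>

lemma step_max_min: "q (Suc t) = max (x (Suc t) - \<rho>) (min (x (Suc t) + \<rho>) (q t))"
  unfolding step saturation_eq_max_min[OF threshold_nonneg] by (auto simp: max_def min_def)

lemma stop_bound: "\<bar>x t - q t\<bar> \<le> \<rho>"
  using threshold_nonneg initial
  by (cases t) (auto simp: step_max_min)

text \<open>An update can raise \<open>q\<close> only as far as the lower end
  \<open>x (Suc t) - \<rho>\<close> of the interval.\<close>

lemma upper_bound:
  assumes "T \<le> t" and "\<And>s. s \<in> {T..t} \<Longrightarrow> x s \<le> M"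
  shows "q t \<le> max (q T) (M - \<rho>)"
  using assms
proof (induction t rule: dec_induct)
  case (step t)
  have "q t \<le> max (q T) (M - \<rho>)" by (rule step.IH) (simp add: step.prems)
  moreover have "x (Suc t) \<le> M" using step by simp
  ultimately show ?case unfolding step_max_min by linarith
qed simp

text \<open>Take \<open>M = x t\<close> in \<open>upper_bound\<close>: either
  \<open>q t \<le> q T\<close> while \<open>x T \<le> x t\<close>, or the stop at \<open>t\<close>
  reaches \<open>\<rho>\<close>, which bounds every stop.\<close>

lemma stop_running_max:
  assumes "T \<le> t" and "\<And>s. s \<in> {T..t} \<Longrightarrow> x s \<le> x t"
  shows "x T - q T \<le> x t - q t"
  using upper_bound[OF assms] stop_bound[of T] assms(2)[of T] assms(1) by auto

text \<open>Take \<open>M = x T + \<delta>\<close> in \<open>upper_bound\<close>; here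
  \<open>x T - \<rho> \<le> q T\<close>, and the case \<open>s = T\<close> forces
  \<open>0 \<le> \<delta>\<close>.\<close>

lemma play_upper_variation:
  assumes "T \<le> t" and "\<And>s. s \<in> {T..t} \<Longrightarrow> x s \<le> x T + \<delta>"
  shows "q t \<le> q T + \<delta>"
  using upper_bound[OF assms] stop_bound[of T] assms(2)[of T] assms(1) by auto

text \<open>The new stop is the old one plus the increment of \<open>x\<close>, clamped to the
  interval from \<open>- \<rho>\<close> to \<open>\<rho>\<close> that already contains the old one.
  So it moves with \<open>x\<close> and no further, which also explains
  \<open>stop_lipschitz\<close>.\<close>

lemma stop_monotone:
  "0 \<le> ((x (Suc t) - q (Suc t)) - (x t - q t)) * (x (Suc t) - x t)"
proof (cases "x t \<le> x (Suc t)")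
  case True
  then have "x t - q t \<le> x (Suc t) - q (Suc t)"
    using stop_bound[of t] unfolding step_max_min by linarith
  then show ?thesis using True by simp
next
  case False
  then have "x (Suc t) - q (Suc t) \<le> x t - q t"
    using stop_bound[of t] unfolding step_max_min by linarith
  then show ?thesis using False by (intro mult_nonpos_nonpos) auto
qed

lemma stop_lipschitz:
  "\<bar>(x (Suc t) - q (Suc t)) - (x t - q t)\<bar> \<le> \<bar>x (Suc t) - x t\<bar>"
  using stop_bound[of t] unfolding step_max_min by linarith

text \<open>The play moves only while the stop is saturated, and then in the direction of the stop.\<close>

lemma stop_dissipation: "0 \<le> (x (Suc t) - q (Suc t)) * (q (Suc t) - q t)"
proof -
  consider "q (Suc t) = q t" | "q (Suc t) = x (Suc t) - \<rho>" "q t \<le> q (Suc t)"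
    | "q (Suc t) = x (Suc t) + \<rho>" "q (Suc t) \<le> q t"
    using threshold_nonneg unfolding step_max_min by linarith
  then show ?thesis
    using threshold_nonneg by cases (simp_all add: mult_nonneg_nonpos)
qed

text \<open>For new and old stops a and b, a^2 - b^2 = 2 a (a - b) - (a - b)^2, and a - b is the
  increment of \<open>x\<close> minus that of \<open>q\<close>; \<open>stop_dissipation\<close>
  discards the latter.\<close>

lemma stop_energy:
  "(x (Suc t) - q (Suc t))\<^sup>2 - (x t - q t)\<^sup>2 \<le> 2 * ((x (Suc t) - q (Suc t)) * (x (Suc t) - x t))"
proof -
  have "0 \<le> ((x (Suc t) - q (Suc t)) - (x t - q t))\<^sup>2" by simp
  with stop_dissipation[of t] show ?thesis by (simp add: power2_eq_square algebra_simps)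
qed

text \<open>Saturation is odd, so every upper estimate has a mirrored lower one.\<close>

lemma negated: "play_sequence \<rho> (\<lambda>t. - x t) (\<lambda>t. - q t)"
proof
  show "- q (Suc t) = - x (Suc t) + saturation \<rho> (- q t - - x (Suc t))" for t
    unfolding step saturation_eq_max_min[OF threshold_nonneg]
    using threshold_nonneg by (auto simp: max_def min_def)
qed (use threshold_nonneg initial in auto)

lemma play_variation:
  assumes "T \<le> t" and "\<And>s. s \<in> {T..t} \<Longrightarrow> \<bar>x s - x T\<bar> \<le> \<delta>"
  shows "\<bar>q t - q T\<bar> \<le> \<delta>"
proof -
  interpret neg: play_sequence \<rho> "\<lambda>t. - x t" "\<lambda>t. - q t" by (rule negated)
  have *: "x s \<le> x T + \<delta> \<and> - x s \<le> - x T + \<delta>" if "s \<in> {T..t}" for s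
    using assms(2)[OF that] by linarith
  have "q t \<le> q T + \<delta>" using assms(1) * by (intro play_upper_variation) auto
  moreover have "- q t \<le> - q T + \<delta>" using assms(1) * by (intro neg.play_upper_variation) auto
  ultimately show ?thesis by linarith
qed

lemma play_convergent:
  assumes "convergent x"
  shows "convergent q"
proof -
  have "Cauchy q"
  proof (rule metric_CauchyI)
    fix e :: real assume "0 < e"
    then obtain T where T: "\<And>s t. T \<le> s \<Longrightarrow> T \<le> t \<Longrightarrow> dist (x s) (x t) < e / 3"
      using metric_CauchyD[OF convergent_Cauchy[OF assms], of "e / 3"] by auto
    have near: "\<bar>q t - q T\<bar> \<le> e / 3" if "T \<le> t" for t
      using that T by (intro play_variation) (auto simp: dist_real_def intro: less_imp_le)
    have "dist (q s) (q t) < e" if "T \<le> s" "T \<le> t" for s t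
      using near[OF that(1)] near[OF that(2)] \<open>0 < e\<close> unfolding dist_real_def by linarith
    then show "\<exists>M. \<forall>m\<ge>M. \<forall>n\<ge>M. dist (q m) (q n) < e" by blast
  qed
  then show ?thesis by (rule Cauchy_convergent)
qed

end

text \<open>Compare \<open>T\<close> with a time \<open>s\<close> where \<open>x\<close> is maximal
  on \<open>{T..t}\<close>: by \<open>stop_running_max\<close> no stop is smaller at
  \<open>s\<close> than at \<open>T\<close>, so \<open>w s - w T\<close> dominates
  \<open>L * (x s - x T)\<close>.\<close>

lemma stop_combination_upper:
  fixes x :: "nat \<Rightarrow> real" and q :: "'i \<Rightarrow> nat \<Rightarrow> real"
    and I :: "'i set" and \<nu> :: "'i \<Rightarrow> real" and L :: real
  defines "w \<equiv> \<lambda>t. L * x t + (\<Sum>i\<in>I. \<nu> i * (x t - q i t))"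
  assumes play: "\<And>i. i \<in> I \<Longrightarrow> play_sequence (\<rho> i) x (q i)"
    and nonneg: "\<And>i. i \<in> I \<Longrightarrow> 0 \<le> \<nu> i" and "0 \<le> L"
    and "T \<le> t" and bound: "\<And>s. s \<in> {T..t} \<Longrightarrow> w s - w T \<le> \<delta>"
  shows "L * (x t - x T) \<le> \<delta>"
proof -
  have "Max (x ` {T..t}) \<in> x ` {T..t}" using \<open>T \<le> t\<close> by (intro Max_in) auto
  then obtain s where "s \<in> {T..t}" "Max (x ` {T..t}) = x s" by (rule imageE)
  then have s: "s \<in> {T..t}" "\<And>r. r \<in> {T..t} \<Longrightarrow> x r \<le> x s"
    using Max_ge[of "x ` {T..t}"] by auto
  have "(\<Sum>i\<in>I. \<nu> i * (x T - q i T)) \<le> (\<Sum>i\<in>I. \<nu> i * (x s - q i s))"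
    using s by (intro sum_mono mult_left_mono nonneg play_sequence.stop_running_max[OF play]) auto
  then have "L * (x s - x T) \<le> w s - w T" by (simp add: w_def algebra_simps)
  moreover have "L * (x t - x T) \<le> L * (x s - x T)"
    using s(2)[of t] \<open>T \<le> t\<close> \<open>0 \<le> L\<close> by (intro mult_left_mono) auto
  ultimately show ?thesis using bound[OF s(1)] by linarith
qed

text \<open>Applying \<open>stop_combination_upper\<close> to \<open>x\<close> and to
  \<open>- x\<close> turns the Cauchy property of the combination into that of
  \<open>x\<close>.\<close>

lemma convergent_if_stop_combination_convergent:
  fixes x :: "nat \<Rightarrow> real" and q :: "'i \<Rightarrow> nat \<Rightarrow> real" and L :: real
  assumes play: "\<And>i. i \<in> I \<Longrightarrow> play_sequence (\<rho> i) x (q i)"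
    and nonneg: "\<And>i. i \<in> I \<Longrightarrow> 0 \<le> \<nu> i" and "0 < L"
    and conv: "convergent (\<lambda>t. L * x t + (\<Sum>i\<in>I. \<nu> i * (x t - q i t)))" (is "convergent ?w")
  shows "convergent x"
proof -
  have "Cauchy x"
  proof (rule metric_CauchyI)
    fix e :: real assume "0 < e"
    define \<delta> where "\<delta> = L * (e / 3)"
    have "0 < \<delta>" using \<open>0 < e\<close> \<open>0 < L\<close> by (simp add: \<delta>_def)
    then obtain T where "\<And>s t. T \<le> s \<Longrightarrow> T \<le> t \<Longrightarrow> dist (?w s) (?w t) < \<delta>"
      using metric_CauchyD[OF convergent_Cauchy[OF conv], of \<delta>] by auto
    then have T: "\<bar>?w s - ?w T\<bar> < \<delta>" if "T \<le> s" for s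
      using that unfolding dist_real_def by blast
    have near: "\<bar>x t - x T\<bar> \<le> e / 3" if "T \<le> t" for t
    proof -
      have "L * (x t - x T) \<le> \<delta>"
      proof (rule stop_combination_upper[where \<rho> = \<rho> and \<nu> = \<nu> and q = q and I = I])
        show "?w s - ?w T \<le> \<delta>" if "s \<in> {T..t}" for s using T[of s] that by auto
      qed (use play nonneg \<open>0 < L\<close> that in auto)
      moreover have "L * (- x t - - x T) \<le> \<delta>"
      proof (rule stop_combination_upper[where \<rho> = \<rho> and \<nu> = \<nu> and q = "\<lambda>i t. - q i t" and I = I])
        have neg: "L * - x s + (\<Sum>i\<in>I. \<nu> i * (- x s - - q i s)) = - ?w s" for s
          by (simp add: sum_negf[symmetric] algebra_simps)
        show "(L * - x s + (\<Sum>i\<in>I. \<nu> i * (- x s - - q i s)))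
            - (L * - x T + (\<Sum>i\<in>I. \<nu> i * (- x T - - q i T))) \<le> \<delta>" if "s \<in> {T..t}" for s
          using T[of s] that unfolding neg by auto
      qed (use play_sequence.negated[OF play] nonneg \<open>0 < L\<close> that in auto)
      ultimately have "L * (x t - x T) \<le> L * (e / 3)" "L * (- x t - - x T) \<le> L * (e / 3)"
        by (simp_all only: \<delta>_def)
      then have "x t - x T \<le> e / 3" "- x t - - x T \<le> e / 3"
        using \<open>0 < L\<close> by (simp_all only: mult_le_cancel_left_pos)
      then show ?thesis by linarith
    qed
    have "dist (x s) (x t) < e" if "T \<le> s" "T \<le> t" for s t
      using near[OF that(1)] near[OF that(2)] \<open>0 < e\<close> unfolding dist_real_def by linarith
    then show "\<exists>M. \<forall>m\<ge>M. \<forall>n\<ge>M. dist (x m) (x n) < e" by blast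
  qed
  then show ?thesis by (rule Cauchy_convergent)
qed

text \<open>\<open>V\<close> is decreasing and bounded below, hence convergent, and its decrements
  squeeze \<open>f\<close>.\<close>

lemma lyapunov_dissipation_tendsto_zero:
  fixes V f :: "nat \<Rightarrow> real"
  assumes "\<And>t. 0 \<le> V t" and "\<And>t. 0 \<le> f t" and decrease: "\<And>t. V (Suc t) + f t \<le> V t"
  shows "f \<longlonglongrightarrow> 0"
proof -
  have "decseq V"
    using assms(2) decrease by (intro decseq_SucI) (metis add_increasing2 order_trans order_refl)
  then obtain l where l: "V \<longlonglongrightarrow> l"
    using assms(1) decseq_convergent by blast
  have "(\<lambda>t. V t - V (Suc t)) \<longlonglongrightarrow> 0"
    using tendsto_diff[OF l LIMSEQ_Suc[OF l]] by simp
  moreover have "f t \<le> V t - V (Suc t)" for t using decrease[of t] by linarith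
  moreover have "(\<lambda>_. 0 :: real) \<longlonglongrightarrow> 0" by simp
  ultimately show ?thesis
    using tendsto_sandwich[of "\<lambda>_. 0" f sequentially "\<lambda>t. V t - V (Suc t)" 0] assms(2) by simp
qed

text \<open>Telescoping; this bounds the initial stops, since \<open>\<beta> i\<close> is the
  initial value of \<open>x\<close> minus that of its play.\<close>

lemma offset_bound:
  fixes \<rho> \<beta> :: "nat \<Rightarrow> real"
  assumes "\<bar>\<beta> 1\<bar> \<le> \<rho> 1" and "\<And>i. i \<in> {2..n} \<Longrightarrow> \<bar>\<beta> i - \<beta> (i - 1)\<bar> \<le> \<rho> i - \<rho> (i - 1)"
    and "i \<in> {1..n}"
  shows "\<bar>\<beta> i\<bar> \<le> \<rho> i"
proof -
  have "1 \<le> i" "i \<le> n" using assms(3) by auto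
  then show ?thesis
  proof (induction i rule: dec_induct)
    case (step i)
    then have "\<bar>\<beta> (Suc i) - \<beta> i\<bar> \<le> \<rho> (Suc i) - \<rho> i" using assms(2)[of "Suc i"] by auto
    then show ?case using step by simp
  qed (use assms(1) in simp)
qed

text \<open>All equations of motion are continuous in two consecutive states, which share the limit
  \<open>e\<close>.\<close>

lemma equilibrium_if_limit:
  assumes "\<And>t. z t \<in> states n" and "xy_equations a1 a2 b1 b2 c1 c2 n \<nu> z"
    and "play_equations n \<rho> z" and nonneg: "\<And>i. i \<in> {1..n} \<Longrightarrow> 0 \<le> \<rho> i"
    and lim: "z \<longlonglongrightarrow> e" and "e \<in> states n"
  shows "equilibrium a1 a2 b1 b2 c1 c2 n \<rho> \<nu> e"
proof -
  have x: "(\<lambda>t. state_x (z t)) \<longlonglongrightarrow> state_x e" and y: "(\<lambda>t. state_y (z t)) \<longlonglongrightarrow> state_y e"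
    by (intro tendsto_intros lim)+
  have q: "(\<lambda>t. state_play (z t) i) \<longlonglongrightarrow> state_play e i" for i
    using tendsto_snd[OF tendsto_snd[OF lim]] by (simp add: tendsto_coordinatewise)
  have p: "(\<lambda>t. state_p n \<nu> (z t)) \<longlonglongrightarrow> state_p n \<nu> e"
    unfolding state_p_def by (intro tendsto_intros q)
  have step: "state_x (z (Suc t))
        = b1 * state_p n \<nu> (z (Suc t)) + (1 - b1) * state_x (z t) + b2 * state_y (z (Suc t))"
      "state_y (z (Suc t)) = (1 - a1) * state_y (z t)
        - a2 * (c1 * state_x (z (Suc t)) + c2 * state_y (z (Suc t)) - state_p n \<nu> (z (Suc t)))" for t
    using assms(2) unfolding xy_equations_def by blast+
  note Suc_lims = LIMSEQ_Suc[OF x] LIMSEQ_Suc[OF y] LIMSEQ_Suc[OF p]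
  have "(\<lambda>t. b1 * state_p n \<nu> (z (Suc t)) + (1 - b1) * state_x (z t) + b2 * state_y (z (Suc t)))
      \<longlonglongrightarrow> b1 * state_p n \<nu> e + (1 - b1) * state_x e + b2 * state_y e"
    by (intro tendsto_intros x Suc_lims)
  then have ex: "state_x e = b1 * state_p n \<nu> e + (1 - b1) * state_x e + b2 * state_y e"
    unfolding step(1)[symmetric] using LIMSEQ_unique Suc_lims(1) by blast
  have "(\<lambda>t. (1 - a1) * state_y (z t)
             - a2 * (c1 * state_x (z (Suc t)) + c2 * state_y (z (Suc t)) - state_p n \<nu> (z (Suc t))))
      \<longlonglongrightarrow> (1 - a1) * state_y e - a2 * (c1 * state_x e + c2 * state_y e - state_p n \<nu> e)"
    by (intro tendsto_intros y Suc_lims)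
  then have ey: "state_y e
      = (1 - a1) * state_y e - a2 * (c1 * state_x e + c2 * state_y e - state_p n \<nu> e)"
    unfolding step(2)[symmetric] using LIMSEQ_unique Suc_lims(2) by blast
  have "state_play e i = state_x e + saturation (\<rho> i) (state_play e i - state_x e)"
    if i: "i \<in> {1..n}" for i
  proof -
    have "(\<lambda>t. state_x (z (Suc t)) + saturation (\<rho> i) (state_play (z t) i - state_x (z (Suc t))))
        \<longlonglongrightarrow> state_x e + saturation (\<rho> i) (state_play e i - state_x e)"
      by (intro tendsto_intros tendsto_saturation nonneg[OF i] q Suc_lims)
    then show ?thesis
      using LIMSEQ_unique LIMSEQ_Suc[OF q[of i]] assms(3) i unfolding play_equations_def by auto
  qed
  with ex ey \<open>e \<in> states n\<close> show ?thesis
    by (simp add: equilibrium_def xy_equations_def play_equations_def)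
qed

theorem theorem3p3:
  fixes a1 a2 b1 b2 c1 c2 :: real
    and n :: nat
    and \<rho> \<nu> \<beta> :: "nat \<Rightarrow> real"
    and z :: "nat \<Rightarrow> state"
  assumes "0 \<le> a1" "a1 < 1"
    and "0 < b1" "b1 < 1"
    and "a2 > 0" "b2 > 0" "c1 > 0" "c2 > 0"
    and "n \<ge> 1"
    and "0 < \<rho> 1" "\<And>i. i \<in> {2..n} \<Longrightarrow> \<rho> (i - 1) < \<rho> i"
    and "\<And>i. i \<in> {1..n} \<Longrightarrow> \<nu> i > 0" "(\<Sum>i=1..n. \<nu> i) \<le> 1"
    and "\<bar>\<beta> 1\<bar> < \<rho> 1"
    and "\<And>i. i \<in> {2..n} \<Longrightarrow> \<bar>\<beta> i - \<beta> (i - 1)\<bar> \<le> \<rho> i - \<rho> (i - 1)"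
    and "c1 > 1"
    and "trajectory a1 a2 b1 b2 c1 c2 n \<rho> \<nu> \<beta> z"
  shows "\<exists>e. equilibrium a1 a2 b1 b2 c1 c2 n \<rho> \<nu> e \<and> z \<longlonglongrightarrow> e"
proof -
  define x where "x = (\<lambda>t. state_x (z t))"
  define y where "y = (\<lambda>t. state_y (z t))"
  define q where "q = (\<lambda>i t. state_play (z t) i)"
  define s where "s = (\<lambda>i t. x t - q i t)"
  define \<sigma> where "\<sigma> = (\<Sum>i=1..n. \<nu> i)"
  define u where "u = (\<lambda>t. x t - state_p n \<nu> (z t))"
  \<comment> \<open>A forward difference, so \<open>v t\<close> is the velocity at time
    \<open>Suc t\<close>.\<close>
  define v where "v = (\<lambda>t. x (Suc t) - x t)"
  define d where "d = a1 + a2 * c2"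
  define m where "m = d * b1 + a2 * b2"
  define K where "K = a2 * b2 * (c1 - 1)"
  define A where "A = 1 - a1"
  define B where "B = 1 - b1"
  \<comment> \<open>The hypothesis \<open>c1 > 1\<close> enters here, as positivity of the restoring
    coefficient \<open>K\<close>.\<close>
  have pos: "0 < d" "0 < m" "0 < K" "0 < A" "0 < B"
    using assms(1-8,16) by (simp_all add: d_def m_def K_def A_def B_def add_nonneg_pos add_pos_pos)
  have \<nu>_nonneg: "0 \<le> \<nu> i" if "i \<in> {1..n}" for i using assms(12)[OF that] by simp
  have states: "\<And>t. z t \<in> states n" and xy: "xy_equations a1 a2 b1 b2 c1 c2 n \<nu> z"
    and plays: "play_equations n \<rho> z" and init: "\<And>i. i \<in> {1..n} \<Longrightarrow> q i 0 = x 0 - \<beta> i"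
    using assms(17) unfolding trajectory_iff by (auto simp: q_def x_def)
  have \<beta>_bound: "\<bar>\<beta> i\<bar> \<le> \<rho> i" if "i \<in> {1..n}" for i
    using offset_bound[of \<beta> \<rho> n i] assms(14,15) that by simp
  have play: "play_sequence (\<rho> i) x (q i)" if "i \<in> {1..n}" for i
    using \<beta>_bound[OF that] init[OF that] plays that
    by unfold_locales (auto simp: play_equations_def q_def x_def)

  \<comment> \<open>Elimination of \<open>y\<close>\<close>
  have u_eq: "u t = (1 - \<sigma>) * x t + (\<Sum>i=1..n. \<nu> i * s i t)" for t
    by (simp add: u_def \<sigma>_def s_def state_p_def q_def sum_distrib_left sum_distrib_right
        sum_subtractf algebra_simps)
  have E1: "B * v t = - b1 * u (Suc t) + b2 * y (Suc t)" for t
  proof -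
    have "x (Suc t) = b1 * (x (Suc t) - u (Suc t)) + (1 - b1) * x t + b2 * y (Suc t)"
      using xy unfolding xy_equations_def u_def x_def y_def by simp
    then show ?thesis unfolding B_def v_def by algebra
  qed
  have E2: "A * (y (Suc t) - y t) = - d * y (Suc t) - a2 * (c1 - 1) * x (Suc t) - a2 * u (Suc t)" for t
  proof -
    have "y (Suc t) = (1 - a1) * y t - a2 * (c1 * x (Suc t) + c2 * y (Suc t) - (x (Suc t) - u (Suc t)))"
      using xy unfolding xy_equations_def u_def x_def y_def diff_diff_eq2 add_diff_cancel_left'
      by blast
    then show ?thesis unfolding A_def d_def by algebra
  qed
  \<comment> \<open>Multiply \<open>E2\<close> at \<open>Suc t\<close> by \<open>b2\<close> and
    substitute \<open>b2 * y\<close> from \<open>E1\<close> at \<open>t\<close> and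
    \<open>Suc t\<close>. The initial \<open>y 0\<close> is unconstrained by \<open>E1\<close>,
    hence the shift to time \<open>t + 2\<close>.\<close>
  have oscillator: "A * B * (v (Suc t) - v t) + A * b1 * (u (Suc (Suc t)) - u (Suc t))
      + d * B * v (Suc t) + m * u (Suc (Suc t)) + K * x (Suc (Suc t)) = 0" for t
    using E1[of t] E1[of "Suc t"] E2[of "Suc t"] unfolding m_def K_def by algebra

  \<comment> \<open>Monotonicity and Lipschitz bound for \<open>u\<close>\<close>
  have u_diff: "u (Suc t) - u t = (1 - \<sigma>) * v t + (\<Sum>i=1..n. \<nu> i * (s i (Suc t) - s i t))" for t
    by (simp add: u_eq v_def sum_subtractf algebra_simps)
  have \<sigma>: "0 \<le> 1 - \<sigma>" using assms(13) by (simp add: \<sigma>_def)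
  have u_monotone: "0 \<le> (u (Suc t) - u t) * v t" for t
  proof -
    have "0 \<le> \<nu> i * (s i (Suc t) - s i t) * v t" if "i \<in> {1..n}" for i
      using \<nu>_nonneg[OF that] play_sequence.stop_monotone[OF play[OF that], of t]
      by (simp add: s_def v_def mult.assoc)
    then have "0 \<le> (\<Sum>i=1..n. \<nu> i * (s i (Suc t) - s i t) * v t)" by (intro sum_nonneg) auto
    moreover have "0 \<le> (1 - \<sigma>) * v t * v t" using \<sigma> by (simp add: mult.assoc)
    ultimately show ?thesis by (simp add: u_diff distrib_right sum_distrib_right)
  qed
  \<comment> \<open>The weights \<open>1 - \<sigma>\<close> and \<open>\<nu> i\<close> are
    nonnegative with sum 1, and each increment they multiply is at most
    \<open>\<bar>v t\<bar>\<close> in absolute value.\<close>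
  have u_lipschitz: "\<bar>u (Suc t) - u t\<bar> \<le> \<bar>v t\<bar>" for t
  proof -
    have "\<bar>\<Sum>i=1..n. \<nu> i * (s i (Suc t) - s i t)\<bar> \<le> (\<Sum>i=1..n. \<nu> i * \<bar>v t\<bar>)"
      using \<nu>_nonneg play_sequence.stop_lipschitz[OF play, of _ t]
      by (intro order_trans[OF sum_abs] sum_mono) (auto simp: abs_mult s_def v_def mult_left_mono)
    also have "\<dots> = \<sigma> * \<bar>v t\<bar>" by (simp add: \<sigma>_def sum_distrib_right)
    finally have "\<bar>u (Suc t) - u t\<bar> \<le> \<bar>(1 - \<sigma>) * v t\<bar> + \<sigma> * \<bar>v t\<bar>"
      unfolding u_diff by linarith
    also have "\<dots> = \<bar>v t\<bar>" unfolding abs_mult abs_of_nonneg[OF \<sigma>] by (simp add: algebra_simps)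
    finally show ?thesis .
  qed

  \<comment> \<open>Energy decay\<close>
  define U where "U = (\<lambda>t. (1 - \<sigma>) * (x t)\<^sup>2 + (\<Sum>i=1..n. \<nu> i * (s i t)\<^sup>2))"
  \<comment> \<open>Convexity of the square, with the slope taken at the new value as the implicit
    scheme requires.\<close>
  have square_diff: "a\<^sup>2 - b\<^sup>2 \<le> 2 * (a * (a - b))" for a b :: real
    using zero_le_power2[of "a - b"] by (simp add: power2_eq_square algebra_simps)
  have U_nonneg: "0 \<le> U t" for t
    using \<sigma> \<nu>_nonneg by (auto simp: U_def intro!: add_nonneg_nonneg sum_nonneg)
  have U_diff: "U (Suc t) - U t \<le> 2 * (u (Suc t) * v t)" for t
  proof -
    have "(\<Sum>i=1..n. \<nu> i * ((s i (Suc t))\<^sup>2 - (s i t)\<^sup>2)) \<le> (\<Sum>i=1..n. \<nu> i * (2 * (s i (Suc t) * v t)))"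
      using play_sequence.stop_energy[OF play, of _ t] \<nu>_nonneg
      by (intro sum_mono mult_left_mono) (auto simp: s_def v_def)
    moreover have "(1 - \<sigma>) * ((x (Suc t))\<^sup>2 - (x t)\<^sup>2) \<le> (1 - \<sigma>) * (2 * (x (Suc t) * v t))"
      unfolding v_def by (intro mult_left_mono square_diff \<sigma>)
    moreover have "U (Suc t) - U t
        = (1 - \<sigma>) * ((x (Suc t))\<^sup>2 - (x t)\<^sup>2) + (\<Sum>i=1..n. \<nu> i * ((s i (Suc t))\<^sup>2 - (s i t)\<^sup>2))"
      by (simp add: U_def sum_subtractf algebra_simps)
    moreover have "2 * (u (Suc t) * v t)
        = (1 - \<sigma>) * (2 * (x (Suc t) * v t)) + (\<Sum>i=1..n. \<nu> i * (2 * (s i (Suc t) * v t)))"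
      by (simp add: u_eq sum_distrib_left sum_distrib_right algebra_simps)
    ultimately show ?thesis by linarith
  qed
  define V where "V = (\<lambda>t. A * B * (v t)\<^sup>2 + m * U (Suc t) + K * (x (Suc t))\<^sup>2)"
  have V_decrease: "V (Suc t) + 2 * d * B * (v (Suc t))\<^sup>2 \<le> V t" for t
  proof -
    let ?v = "v (Suc t)"
    have "V (Suc t) - V t = A * B * (?v\<^sup>2 - (v t)\<^sup>2) + m * (U (Suc (Suc t)) - U (Suc t))
        + K * ((x (Suc (Suc t)))\<^sup>2 - (x (Suc t))\<^sup>2)"
      by (simp add: V_def algebra_simps)
    also have "\<dots> \<le> A * B * (2 * (?v * (?v - v t))) + m * (2 * (u (Suc (Suc t)) * ?v))
        + K * (2 * (x (Suc (Suc t)) * ?v))"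
      using pos U_diff[of "Suc t"] square_diff[of "x (Suc (Suc t))" "x (Suc t)"] square_diff[of ?v "v t"]
      by (intro add_mono mult_left_mono) (auto simp: v_def)
    \<comment> \<open>This is the oscillator equation multiplied by \<open>2 * ?v\<close>.\<close>
    also have "\<dots> = - 2 * d * B * ?v\<^sup>2 - 2 * A * b1 * ((u (Suc (Suc t)) - u (Suc t)) * ?v)"
      using oscillator[of t] by algebra
    also have "\<dots> \<le> - 2 * d * B * ?v\<^sup>2"
      using u_monotone[of "Suc t"] pos assms(3) by simp
    finally show ?thesis by linarith
  qed
  have "(\<lambda>t. 2 * d * B * (v (Suc t))\<^sup>2) \<longlonglongrightarrow> 0"
    using pos U_nonneg by (intro lyapunov_dissipation_tendsto_zero[where V = V] V_decrease)
      (auto simp: V_def intro!: add_nonneg_nonneg)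
  from tendsto_mult[OF tendsto_const[of "1 / (2 * d * B)"] this]
  have "(\<lambda>t. (v (Suc t))\<^sup>2) \<longlonglongrightarrow> 0" using pos by simp
  then have v0: "(\<lambda>t. v (Suc t)) \<longlonglongrightarrow> 0" by (simp add: power_tendsto_0_iff)
  then have v0': "v \<longlonglongrightarrow> 0" by (rule LIMSEQ_imp_Suc)
  have du0: "(\<lambda>t. u (Suc (Suc t)) - u (Suc t)) \<longlonglongrightarrow> 0"
    by (rule Lim_null_comparison[OF _ tendsto_rabs_zero[OF v0]]) (simp add: u_lipschitz)

  \<comment> \<open>Convergence of \<open>x\<close>\<close>
  have "(\<lambda>t. - (A * B * (v (Suc t) - v t) + A * b1 * (u (Suc (Suc t)) - u (Suc t)) + d * B * v (Suc t)))
      \<longlonglongrightarrow> - (A * B * (0 - 0) + A * b1 * 0 + d * B * 0)"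
    by (intro tendsto_intros v0 v0' du0)
  moreover have "- (A * B * (v (Suc t) - v t) + A * b1 * (u (Suc (Suc t)) - u (Suc t)) + d * B * v (Suc t))
      = m * u (Suc (Suc t)) + K * x (Suc (Suc t))" for t
    using oscillator[of t] by linarith
  ultimately have "(\<lambda>t. m * u (Suc (Suc t)) + K * x (Suc (Suc t))) \<longlonglongrightarrow> 0" by simp
  then have w: "(\<lambda>t. m * u t + K * x t) \<longlonglongrightarrow> 0"
    by (rule LIMSEQ_imp_Suc[OF LIMSEQ_imp_Suc])
  have "convergent x"
  proof (rule convergent_if_stop_combination_convergent[where \<nu> = "\<lambda>i. m * \<nu> i" and q = q])
    have "(m * (1 - \<sigma>) + K) * x t + (\<Sum>i=1..n. m * \<nu> i * (x t - q i t)) = m * u t + K * x t" for t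
      by (simp add: u_eq s_def sum_distrib_left algebra_simps)
    then show "convergent (\<lambda>t. (m * (1 - \<sigma>) + K) * x t + (\<Sum>i=1..n. m * \<nu> i * (x t - q i t)))"
      using w by (simp add: convergentI)
    \<comment> \<open>Positivity of \<open>K\<close> covers the case
      \<open>\<sigma> = 1\<close>.\<close>
    show "0 < m * (1 - \<sigma>) + K" using pos \<sigma> by (simp add: add_nonneg_pos)
  qed (use play \<nu>_nonneg pos in auto)
  then obtain X where X: "x \<longlonglongrightarrow> X" by (auto simp: convergent_def)

  \<comment> \<open>Convergence of the remaining coordinates\<close>
  have "\<exists>l. q i \<longlonglongrightarrow> l" if "i \<in> {1..n}" for i
    using play_sequence.play_convergent[OF play[OF that] \<open>convergent x\<close>] by (simp add: convergent_def)
  then obtain Q where Q: "\<And>i. i \<in> {1..n} \<Longrightarrow> q i \<longlonglongrightarrow> Q i" by metis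
  have u_lim: "u \<longlonglongrightarrow> X - (\<Sum>i=1..n. \<nu> i * Q i)"
    unfolding u_def state_p_def using Q by (intro tendsto_intros X) (auto simp: q_def)
  \<comment> \<open>The limit of \<open>y\<close> is read off from \<open>E1\<close>, solved for
    \<open>y (Suc t)\<close>.\<close>
  have "(\<lambda>t. (B * v t + b1 * u (Suc t)) / b2) \<longlonglongrightarrow> (B * 0 + b1 * (X - (\<Sum>i=1..n. \<nu> i * Q i))) / b2"
    using assms(6) by (intro tendsto_intros v0' LIMSEQ_Suc[OF u_lim]) simp
  moreover have "(B * v t + b1 * u (Suc t)) / b2 = y (Suc t)" for t
    using E1[of t] assms(6) by (simp add: field_simps)
  ultimately obtain Y where Y: "y \<longlonglongrightarrow> Y"
    using LIMSEQ_imp_Suc[of y] by auto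
  define e where "e = (X, Y, restrict Q {1..n})"
  have "(\<lambda>t. state_play (z t)) \<longlonglongrightarrow> restrict Q {1..n}"
  proof (rule tendsto_coordinatewise[THEN iffD2], rule allI)
    fix i
    show "(\<lambda>t. state_play (z t) i) \<longlonglongrightarrow> restrict Q {1..n} i"
    proof (cases "i \<in> {1..n}")
      case True
      then show ?thesis using Q[OF True] by (simp add: q_def)
    next
      \<comment> \<open>Outside \<open>{1..n}\<close> both the states and \<open>restrict\<close>
        take the default value \<open>undefined\<close>.\<close>
      case False
      have "state_play (z t) \<in> {1..n} \<rightarrow>\<^sub>E UNIV" for t
        using states[of t] unfolding states_def by (simp only: mem_Times_iff)
      then have "state_play (z t) i = undefined" for t
        using False by (rule PiE_arb)
      then show ?thesis using False by (simp only: restrict_def if_False tendsto_const)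
    qed
  qed
  then have "(\<lambda>t. (x t, y t, state_play (z t))) \<longlonglongrightarrow> e"
    unfolding e_def by (intro tendsto_Pair X Y)
  then have lim: "z \<longlonglongrightarrow> e" by (simp add: x_def y_def)
  have "e \<in> states n" by (simp add: e_def states_def)
  moreover have "0 \<le> \<rho> i" if "i \<in> {1..n}" for i using \<beta>_bound[OF that] by linarith
  ultimately have "equilibrium a1 a2 b1 b2 c1 c2 n \<rho> \<nu> e"
    using states xy plays lim by (intro equilibrium_if_limit[of z]) auto
  with lim show ?thesis by blast
qed

end
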